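(* Assume: (a) $\mathcal S\subset\mathbb R^m$ and $\mathcal A\subset\mathbb R^n$ are convex and compact; (b) for each $\xi\in\Xi$, $\mathcal C(s,a,\xi)$ is convex and continuous in $(s,a)\in\mathcal S\times\mathcal A$; (c) $g(s,a,\xi)=A(\xi)s+B(\xi)a+b(\xi)$ with $A:\Xi\to\mathbb R^{m\times m}$, $B:\Xi\to\mathbb R^{m\times n}$, $b:\Xi\to\mathbb R^m$ measurable. Then the Bellman-operator cutting-plane (BOCP) update for episode $N$ produces a sequence $\{\underline V_N^k\}_{k\ge0}$ such that, for all $k$, $$\underline V_N^k\le\underline V_N^{k+1}\le\hat V_N^*\quad\text{pointwise on }\mathcal S.$$ In particular, the pointwise limit $\underline V_N^\infty(s):=\lim_{k\to\infty}\underline V_N^k(s)$ exists and satisfies $\underline V_N^\infty\le\hat V_N^*$.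
   Context: Model: $\mathcal S,\mathcal A$ are nonempty; $\Xi=\{\xi^1,\dots,\xi^J\}\subseteq\mathbb R^k$ is finite; $\mathscr P(\Xi)$ is identified with the probability vectors $(p_j)_{j=1}^J$, $p_j=P(\xi=\xi^j)$. $\mathcal C:\mathcal S\times\mathcal A\times\Xi\to\mathbb R$, $g:\mathcal S\times\mathcal A\times\Xi\to\mathcal S$, $\gamma\in[0,1)$, $\bar{\mathcal C}=\sup_{s,a,\xi}|\mathcal C(s,a,\xi)|<\infty$; $\mathcal C^j(s,a)=\mathcal C(s,a,\xi^j)$, $A^j=A(\xi^j)$, $B^j=B(\xi^j)$, $b^j=b(\xi^j)$. Ambiguity set of episode $N$: with $\tau_{j,0}>1$, data $\hat\xi_1,\dots,\hat\xi_N\in\Xi$, $\tau_{j,N}=\tau_{j,0}+\sum_{i=1}^N\mathbf 1_{\{\hat\xi_i=\xi^j\}}$, $\alpha\in(0,1)$, $\alpha'=\alpha/J$, $z_{1-\alpha'/2}$ the standard normal $(1-\alpha'/2)$-quantile: $\hat p_{j,N}=\frac{\tau_{j,N}-1}{\sum_k\tau_{k,N}-J}$, $\hat r_{j,N}=z_{1-\alpha'/2}\sqrt{\frac{\hat p_{j,N}(1-\hat p_{j,N})}{\sum_k\tau_{k,N}-J}}$, $\mathfrak P(\hat P_N,\hat r_N)=\{P\in\mathscr P(\Xi):\hat p_{j,N}-\hat r_{j,N}\le p_j\le\hat p_{j,N}+\hat r_{j,N}\ \forall j\}$. Put $\hat p^l_{j,N}=\max\{0,\hat p_{j,N}-\hat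 r_{j,N}\}$, $\hat p^u_{j,N}=\min\{1,\hat p_{j,N}+\hat r_{j,N}\}$, $\mathbf L=\sum_j\hat p^l_{j,N}\in(0,1)$, $\mathbf U=\sum_j\hat p^u_{j,N}>1$, $p^l_{j,N}=\hat p^l_{j,N}/\mathbf L$, $p^{u-l}_{j,N}=(\hat p^u_{j,N}-\hat p^l_{j,N})/(\mathbf U-\mathbf L)$, $\lambda_N=\mathbf L$, $\upsilon_N=(\mathbf U-1)/(\mathbf U-\mathbf L)$. Bellman operator on bounded functions $V:\mathcal S\to\mathbb R$: $\hat{\mathcal L}_N(V)(s)=\inf_{a\in\mathcal A}\sup_{P\in\mathfrak P(\hat P_N,\hat r_N)}\mathbb E_P[\mathcal C(s,a,\xi)+\gamma V(g(s,a,\xi))]$; it equals $\inf_{a\in\mathcal A,\zeta\in\mathbb R}\big\{\lambda_N\sum_jp^l_{j,N}h_j+(1-\lambda_N)\zeta+\frac{1-\lambda_N}{1-\upsilon_N}\sum_jp^{u-l}_{j,N}[h_j-\zeta]^+\big\}$ with $h_j=\mathcal C^j(s,a)+\gamma V(A^js+B^ja+b^j)$. $\hat V_N^*$ is its unique bounded fixed point. BOCP algorithm (fixed $N$): start with $\bar s_0\in\mathcal S$ and $\underline V_N^0\equiv-\bar{\mathcal C}/(1-\gamma)$. At iteration $k=0,1,2,\dots$: (1) Let $(\bar a_k,\bar\zeta_k,\bar y)$ minimize, over $a\in\mathcal A$, $\zeta\in\mathbb R$, $y\in\mathbb R_+^J$, the function $\lambda_N\sum_jp^l_{j,N}[\mathcal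 C^j(\bar s_k,a)+\gamma\underline V_N^k(A^j\bar s_k+B^ja+b^j)]+(1-\lambda_N)\zeta+\frac{1-\lambda_N}{1-\upsilon_N}\sum_jp^{u-l}_{j,N}y_j$ subject to $y_j\ge\mathcal C^j(\bar s_k,a)+\gamma\underline V_N^k(A^j\bar s_k+B^ja+b^j)-\zeta$ for all $j$. (2) Let $\mathfrak a_j^\star\ge0$ be optimal (KKT) multipliers of the latter constraints (and $\mathfrak b_j^\star\ge0$ those of $y_j\ge0$), and $\theta_j=\frac{(1-\upsilon_N)\mathfrak a_j^\star}{(1-\lambda_N)p^{u-l}_{j,N}}$. (3) With $s_j'=A^j\bar s_k+B^j\bar a_k+b^j$, set $\underline v_k=\lambda_N\sum_jp^l_{j,N}[\mathcal C^j(\bar s_k,\bar a_k)+\gamma\underline V_N^k(s_j')]+(1-\lambda_N)\bar\zeta_k+\frac{1-\lambda_N}{1-\upsilon_N}\sum_jp^{u-l}_{j,N}[\mathcal C^j(\bar s_k,\bar a_k)+\gamma\underline V_N^k(s_j')-\bar\zeta_k]^+$ (which equals $\hat{\mathcal L}_N(\underline V_N^k)(\bar s_k)$), and choose an operator-level subgradient $q_k\in\sum_j\big(\lambda_Np^l_{j,N}+\frac{1-\lambda_N}{1-\upsilon_N}p^{u-l}_{j,N}\theta_j\big)\big[\partial_s\mathcal C^j(\bar s_k,\bar a_k)+\gamma(A^j)^\top\partial\underline V_N^k(s_j')\big]$ (convex subdifferentials, $\partial_s$ being the block in $s$) such that the cut $\ell_{k+1}(s)=\underline v_k+q_k^\top(s-\bar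 s_k)$ is supporting, i.e. $\ell_{k+1}\le\hat{\mathcal L}_N(\underline V_N^k)$ on $\mathcal S$. (4) $\underline V_N^{k+1}=\max\{\underline V_N^k,\ell_{k+1}\}$; draw $\xi^j\in\Xi$ at random and set $\bar s_{k+1}=A^j\bar s_k+B^j\bar a_k+b^j$. *)

theory Defs
  imports "HOL-Probability.Probability"
begin

section \<open>Ambiguity sets\<close>

text \<open>The outcome space is \<open>range xi\<close> with \<open>xi\<close> injective on a finite index type \<open>'j\<close>, so that
  \<open>J = CARD('j)\<close> and a probability on it is a vector in \<open>real ^ 'j\<close>. The data points are
  \<open>xh 1, ..., xh N\<close>.\<close>

definition quantile :: "real measure \<Rightarrow> real \<Rightarrow> real" where
  "quantile M q = Inf {x. q \<le> cdf M x}"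

definition tau :: "('j \<Rightarrow> 'x) \<Rightarrow> ('j \<Rightarrow> real) \<Rightarrow> (nat \<Rightarrow> 'x) \<Rightarrow> nat \<Rightarrow> 'j \<Rightarrow> real" where
  "tau xi tau0 xh N j = tau0 j + (\<Sum>i=1..N. indicator {xi j} (xh i))"

definition tau_excess :: "('j::finite \<Rightarrow> 'x) \<Rightarrow> ('j \<Rightarrow> real) \<Rightarrow> (nat \<Rightarrow> 'x) \<Rightarrow> nat \<Rightarrow> real" where
  "tau_excess xi tau0 xh N = (\<Sum>j\<in>UNIV. tau xi tau0 xh N j) - real CARD('j)"

definition p_hat :: "('j::finite \<Rightarrow> 'x) \<Rightarrow> ('j \<Rightarrow> real) \<Rightarrow> (nat \<Rightarrow> 'x) \<Rightarrow> nat \<Rightarrow> 'j \<Rightarrow> real" where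
  "p_hat xi tau0 xh N j = (tau xi tau0 xh N j - 1) / tau_excess xi tau0 xh N"

definition r_hat ::
    "real \<Rightarrow> ('j::finite \<Rightarrow> 'x) \<Rightarrow> ('j \<Rightarrow> real) \<Rightarrow> (nat \<Rightarrow> 'x) \<Rightarrow> nat \<Rightarrow> 'j \<Rightarrow> real" where
  "r_hat alpha xi tau0 xh N j =
     quantile std_normal_distribution (1 - (alpha / real CARD('j)) / 2)
       * sqrt (p_hat xi tau0 xh N j * (1 - p_hat xi tau0 xh N j) / tau_excess xi tau0 xh N)"

definition prob_vectors :: "(real ^ 'j::finite) set" where
  "prob_vectors = {p. (\<forall>j. 0 \<le> p $ j) \<and> (\<Sum>j\<in>UNIV. p $ j) = 1}"

definition ambiguity_set :: "('j::finite \<Rightarrow> real) \<Rightarrow> ('j \<Rightarrow> real) \<Rightarrow> (real ^ 'j) set" where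
  "ambiguity_set ph rh =
     {p \<in> prob_vectors. \<forall>j. ph j - rh j \<le> p $ j \<and> p $ j \<le> ph j + rh j}"

definition p_lo :: "('j \<Rightarrow> real) \<Rightarrow> ('j \<Rightarrow> real) \<Rightarrow> 'j \<Rightarrow> real" where
  "p_lo ph rh j = max 0 (ph j - rh j)"

definition p_up :: "('j \<Rightarrow> real) \<Rightarrow> ('j \<Rightarrow> real) \<Rightarrow> 'j \<Rightarrow> real" where
  "p_up ph rh j = min 1 (ph j + rh j)"

definition L_sum :: "('j::finite \<Rightarrow> real) \<Rightarrow> ('j \<Rightarrow> real) \<Rightarrow> real" where
  "L_sum ph rh = (\<Sum>j\<in>UNIV. p_lo ph rh j)"

definition U_sum :: "('j::finite \<Rightarrow> real) \<Rightarrow> ('j \<Rightarrow> real) \<Rightarrow> real" where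
  "U_sum ph rh = (\<Sum>j\<in>UNIV. p_up ph rh j)"

definition p_l :: "('j::finite \<Rightarrow> real) \<Rightarrow> ('j \<Rightarrow> real) \<Rightarrow> 'j \<Rightarrow> real" where
  "p_l ph rh j = p_lo ph rh j / L_sum ph rh"

definition p_ul :: "('j::finite \<Rightarrow> real) \<Rightarrow> ('j \<Rightarrow> real) \<Rightarrow> 'j \<Rightarrow> real" where
  "p_ul ph rh j = (p_up ph rh j - p_lo ph rh j) / (U_sum ph rh - L_sum ph rh)"

definition lam :: "('j::finite \<Rightarrow> real) \<Rightarrow> ('j \<Rightarrow> real) \<Rightarrow> real" where
  "lam ph rh = L_sum ph rh"

definition ups :: "('j::finite \<Rightarrow> real) \<Rightarrow> ('j \<Rightarrow> real) \<Rightarrow> real" where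
  "ups ph rh = (U_sum ph rh - 1) / (U_sum ph rh - L_sum ph rh)"

section \<open>Bellman operator\<close>

text \<open>Value functions are total functions of which only the values on the state space \<open>S\<close> matter.\<close>

definition bellman ::
    "'a set \<Rightarrow> ('j::finite \<Rightarrow> 'x) \<Rightarrow> ('s \<Rightarrow> 'a \<Rightarrow> 'x \<Rightarrow> real) \<Rightarrow> ('s \<Rightarrow> 'a \<Rightarrow> 'x \<Rightarrow> 's) \<Rightarrow> real \<Rightarrow>
     (real ^ 'j) set \<Rightarrow> ('s \<Rightarrow> real) \<Rightarrow> 's \<Rightarrow> real" where
  "bellman A xi C g \<gamma> P V s =
     (INF a\<in>A. SUP p\<in>P. \<Sum>j\<in>UNIV. p $ j * (C s a (xi j) + \<gamma> * V (g s a (xi j))))"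

text \<open>Extensionality makes the fixed point on \<open>S\<close> unique as a total function.\<close>

definition bellman_fixpoint ::
    "'s set \<Rightarrow> 'a set \<Rightarrow> ('j::finite \<Rightarrow> 'x) \<Rightarrow> ('s \<Rightarrow> 'a \<Rightarrow> 'x \<Rightarrow> real) \<Rightarrow> ('s \<Rightarrow> 'a \<Rightarrow> 'x \<Rightarrow> 's) \<Rightarrow>
     real \<Rightarrow> (real ^ 'j) set \<Rightarrow> 's \<Rightarrow> real" where
  "bellman_fixpoint S A xi C g \<gamma> P =
     (THE V. V \<in> extensional S \<and> bounded (V ` S) \<and> (\<forall>s\<in>S. bellman A xi C g \<gamma> P V s = V s))"

definition cost_bound ::
    "'s set \<Rightarrow> 'a set \<Rightarrow> ('j \<Rightarrow> 'x) \<Rightarrow> ('s \<Rightarrow> 'a \<Rightarrow> 'x \<Rightarrow> real) \<Rightarrow> real" where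
  "cost_bound S A xi C = (SUP (s, a, x)\<in>S \<times> A \<times> range xi. \<bar>C s a x\<bar>)"

section \<open>Cutting-plane update\<close>

text \<open>Subdifferential at \<open>x\<close> of \<open>f\<close> regarded as a function with domain \<open>D\<close>, that is, extended by
  infinity outside of \<open>D\<close>.\<close>

definition subdifferential :: "'a::real_inner set \<Rightarrow> ('a \<Rightarrow> real) \<Rightarrow> 'a \<Rightarrow> 'a set" where
  "subdifferential D f x = {v. \<forall>y\<in>D. f x + v \<bullet> (y - x) \<le> f y}"

definition affine_step ::
    "('x \<Rightarrow> real ^ 'm ^ 'm) \<Rightarrow> ('x \<Rightarrow> real ^ 'n ^ 'm) \<Rightarrow> ('x \<Rightarrow> real ^ 'm) \<Rightarrow>
     real ^ 'm \<Rightarrow> real ^ 'n \<Rightarrow> 'x \<Rightarrow> real ^ 'm" where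
  "affine_step Am Bm bm s a x = Am x *v s + Bm x *v a + bm x"

definition dual_objective ::
    "('j::finite \<Rightarrow> real) \<Rightarrow> ('j \<Rightarrow> real) \<Rightarrow> ('j \<Rightarrow> real) \<Rightarrow> real \<Rightarrow> ('j \<Rightarrow> real) \<Rightarrow> real" where
  "dual_objective ph rh h \<zeta> y =
     lam ph rh * (\<Sum>j\<in>UNIV. p_l ph rh j * h j) + (1 - lam ph rh) * \<zeta>
     + (1 - lam ph rh) / (1 - ups ph rh) * (\<Sum>j\<in>UNIV. p_ul ph rh j * y j)"

text \<open>In the next two definitions \<open>h a j\<close> is the cost-to-go of action \<open>a\<close> under outcome \<open>j\<close>.\<close>

definition is_subproblem_solution ::
    "('a set) \<Rightarrow> ('j::finite \<Rightarrow> real) \<Rightarrow> ('j \<Rightarrow> real) \<Rightarrow> ('a \<Rightarrow> 'j \<Rightarrow> real) \<Rightarrow>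
     'a \<Rightarrow> real \<Rightarrow> real ^ 'j \<Rightarrow> bool" where
  "is_subproblem_solution A ph rh h a \<zeta> y \<longleftrightarrow>
     is_arg_min (\<lambda>(a, \<zeta>, y). dual_objective ph rh (h a) \<zeta> (($) y))
       (\<lambda>(a, \<zeta>, y). a \<in> A \<and> (\<forall>j. 0 \<le> y $ j) \<and> (\<forall>j. h a j - \<zeta> \<le> y $ j)) (a, \<zeta>, y)"

text \<open>KKT conditions of the subproblem: the multipliers \<open>ma\<close> and \<open>mb\<close> of \<open>h a j - \<zeta> - y $ j \<le> 0\<close>
  and \<open>- y $ j \<le> 0\<close> are nonnegative and complementary, and the Lagrangian, with \<open>a \<in> A\<close> kept as an
  abstract constraint, is stationary.\<close>

definition is_kkt_multiplier ::
    "('a::real_inner set) \<Rightarrow> ('j::finite \<Rightarrow> real) \<Rightarrow> ('j \<Rightarrow> real) \<Rightarrow> ('a \<Rightarrow> 'j \<Rightarrow> real) \<Rightarrow>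
     'a \<Rightarrow> real \<Rightarrow> real ^ 'j \<Rightarrow> ('j \<Rightarrow> real) \<Rightarrow> ('j \<Rightarrow> real) \<Rightarrow> bool" where
  "is_kkt_multiplier A ph rh h a \<zeta> y ma mb \<longleftrightarrow>
     (\<forall>j. 0 \<le> ma j \<and> 0 \<le> mb j) \<and>
     (\<forall>j. ma j * (h a j - \<zeta> - y $ j) = 0 \<and> mb j * y $ j = 0) \<and>
     0 \<in> subdifferential (A \<times> UNIV \<times> UNIV)
           (\<lambda>(a, \<zeta>, y). dual_objective ph rh (h a) \<zeta> (($) y)
              + (\<Sum>j\<in>UNIV. ma j * (h a j - \<zeta> - y $ j)) - (\<Sum>j\<in>UNIV. mb j * y $ j))
           (a, \<zeta>, y)"

definition operator_subgradients ::
    "(real ^ 'm) set \<Rightarrow> (real ^ 'n) set \<Rightarrow> ('j::finite \<Rightarrow> 'x) \<Rightarrow>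
     (real ^ 'm \<Rightarrow> real ^ 'n \<Rightarrow> 'x \<Rightarrow> real) \<Rightarrow>
     ('x \<Rightarrow> real ^ 'm ^ 'm) \<Rightarrow> ('x \<Rightarrow> real ^ 'n ^ 'm) \<Rightarrow> ('x \<Rightarrow> real ^ 'm) \<Rightarrow> real \<Rightarrow>
     ('j \<Rightarrow> real) \<Rightarrow> ('j \<Rightarrow> real) \<Rightarrow> (real ^ 'm \<Rightarrow> real) \<Rightarrow>
     real ^ 'm \<Rightarrow> real ^ 'n \<Rightarrow> ('j \<Rightarrow> real) \<Rightarrow> (real ^ 'm) set" where
  "operator_subgradients S A xi C Am Bm bm \<gamma> ph rh V s a \<theta> =
     {\<Sum>j\<in>UNIV. (lam ph rh * p_l ph rh j
                   + (1 - lam ph rh) / (1 - ups ph rh) * p_ul ph rh j * \<theta> j)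
                 *\<^sub>R (u j + \<gamma> *\<^sub>R (transpose (Am (xi j)) *v w j)) | u w.
        \<forall>j. u j \<in> fst ` subdifferential (S \<times> A) (\<lambda>(s, a). C s a (xi j)) (s, a) \<and>
            w j \<in> subdifferential S V (affine_step Am Bm bm s a (xi j))}"

definition bocp_step ::
    "(real ^ 'm) set \<Rightarrow> (real ^ 'n) set \<Rightarrow> ('j::finite \<Rightarrow> 'x) \<Rightarrow>
     (real ^ 'm \<Rightarrow> real ^ 'n \<Rightarrow> 'x \<Rightarrow> real) \<Rightarrow> (real ^ 'm \<Rightarrow> real ^ 'n \<Rightarrow> 'x \<Rightarrow> real ^ 'm) \<Rightarrow>
     ('x \<Rightarrow> real ^ 'm ^ 'm) \<Rightarrow> ('x \<Rightarrow> real ^ 'n ^ 'm) \<Rightarrow> ('x \<Rightarrow> real ^ 'm) \<Rightarrow> real \<Rightarrow>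
     ('j \<Rightarrow> real) \<Rightarrow> ('j \<Rightarrow> real) \<Rightarrow>
     real ^ 'm \<Rightarrow> (real ^ 'm \<Rightarrow> real) \<Rightarrow> real ^ 'm \<Rightarrow> (real ^ 'm \<Rightarrow> real) \<Rightarrow> bool" where
  "bocp_step S A xi C g Am Bm bm \<gamma> ph rh s V s' V' \<longleftrightarrow>
     (\<exists>a \<zeta> y ma mb \<theta> v q.
        let h = (\<lambda>a j. C s a (xi j) + \<gamma> * V (affine_step Am Bm bm s a (xi j)))
        in is_subproblem_solution A ph rh h a \<zeta> y \<and>
           is_kkt_multiplier A ph rh h a \<zeta> y ma mb \<and>
           (\<forall>j. \<theta> j = (1 - ups ph rh) * ma j / ((1 - lam ph rh) * p_ul ph rh j)) \<and>
           v = dual_objective ph rh (h a) \<zeta> (\<lambda>j. max 0 (h a j - \<zeta>)) \<and>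
           q \<in> operator_subgradients S A xi C Am Bm bm \<gamma> ph rh V s a \<theta> \<and>
           (\<forall>t\<in>S. v + q \<bullet> (t - s) \<le> bellman A xi C g \<gamma> (ambiguity_set ph rh) V t) \<and>
           (\<forall>t\<in>S. V' t = max (V t) (v + q \<bullet> (t - s))) \<and>
           (\<exists>j. s' = affine_step Am Bm bm s a (xi j)))"

text \<open>A run of the algorithm: visited states \<open>sb\<close> and lower approximations \<open>V\<close>, for arbitrary
  choices of minimizers, multipliers and subgradients and for arbitrary sampled outcomes.\<close>

definition bocp_run ::
    "(real ^ 'm) set \<Rightarrow> (real ^ 'n) set \<Rightarrow> ('j::finite \<Rightarrow> 'x) \<Rightarrow>
     (real ^ 'm \<Rightarrow> real ^ 'n \<Rightarrow> 'x \<Rightarrow> real) \<Rightarrow> (real ^ 'm \<Rightarrow> real ^ 'n \<Rightarrow> 'x \<Rightarrow> real ^ 'm) \<Rightarrow>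
     ('x \<Rightarrow> real ^ 'm ^ 'm) \<Rightarrow> ('x \<Rightarrow> real ^ 'n ^ 'm) \<Rightarrow> ('x \<Rightarrow> real ^ 'm) \<Rightarrow> real \<Rightarrow>
     ('j \<Rightarrow> real) \<Rightarrow> ('j \<Rightarrow> real) \<Rightarrow>
     (nat \<Rightarrow> real ^ 'm) \<Rightarrow> (nat \<Rightarrow> real ^ 'm \<Rightarrow> real) \<Rightarrow> bool" where
  "bocp_run S A xi C g Am Bm bm \<gamma> ph rh sb V \<longleftrightarrow>
     sb 0 \<in> S \<and> (\<forall>s\<in>S. V 0 s = - cost_bound S A xi C / (1 - \<gamma>)) \<and>
     (\<forall>k. bocp_step S A xi C g Am Bm bm \<gamma> ph rh (sb k) (V k) (sb (Suc k)) (V (Suc k)))"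

end

theory Submission
  imports Defs
begin

text \<open>By symmetry the normal quantile above level 1/2 is nonnegative, so the nominal distribution lies
  in the ambiguity set. The Bellman operator is then monotone and a \<open>\<gamma>\<close>-contraction on bounded
  functions, which yields a comparison principle: a bounded \<open>U\<close> below its own Bellman image is below
  every bounded \<open>W\<close> above its own Bellman image. The lower approximations of a run are bounded and stay
  below their Bellman images, because a supporting cut lies below the image of the previous
  approximation and the operator is monotone.\<close>

section \<open>The nominal distribution\<close>

text \<open>The density is even, so reflection gives \<open>{..x}\<close> and \<open>{- x..}\<close>
  the same mass. For negative \<open>x\<close> they are disjoint, hence twice this mass is at most
  one.\<close>

lemma cdf_std_normal_le_half:
  assumes "x < 0"
  shows "cdf std_normal_distribution x \<le> 1 / 2"
proof -
  interpret prob_space std_normal_distribution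
    by (simp add: prob_space_normal_density)
  have "emeasure std_normal_distribution {..x} =
      (\<integral>\<^sup>+ y. ennreal (std_normal_density y) * indicator {..x} y \<partial>lborel)"
    by (simp add: emeasure_density)
  also have "\<dots> = (\<integral>\<^sup>+ y. ennreal (std_normal_density (- y)) * indicator {..x} (- y) \<partial>lborel)"
    using nn_integral_real_affine[of "\<lambda>y. ennreal (std_normal_density y) * indicator {..x} y" "-1" 0]
    by simp
  also have "\<dots> = (\<integral>\<^sup>+ y. ennreal (std_normal_density y) * indicator {- x..} y \<partial>lborel)"
    by (intro nn_integral_cong) (auto simp: std_normal_density_def indicator_def)
  also have "\<dots> = emeasure std_normal_distribution {- x..}"
    by (simp add: emeasure_density)
  finally have "prob {..x} = prob {- x..}"
    by (simp add: measure_def)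
  moreover have "prob ({..x} \<union> {- x..}) = prob {..x} + prob {- x..}"
    using assms by (intro finite_measure_Union) auto
  moreover have "prob ({..x} \<union> {- x..}) \<le> 1"
    by simp
  ultimately show ?thesis
    by (simp add: cdf_def)
qed

text \<open>A negative \<open>x\<close> has cdf at most 1/2 < \<open>q\<close>, so it is not in the
  set whose infimum is the quantile.\<close>

lemma quantile_std_normal_nonneg:
  assumes "1 / 2 < q" "q < 1"
  shows "0 \<le> quantile std_normal_distribution q"
proof -
  interpret real_distribution std_normal_distribution
    by (rule real_dist_normal_dist)
  \<comment> \<open>A lower bound passes to the real \<open>Inf\<close> only for a nonempty set; the
    limit 1 of the cdf at infinity exceeds \<open>q\<close> and provides an element.\<close>
  have "eventually (\<lambda>x. q < cdf std_normal_distribution x) at_top"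
    using cdf_lim_at_top_prob assms(2) by (rule order_tendstoD)
  then obtain x where "q < cdf std_normal_distribution x"
    by (metis eventually_at_top_linorder order_refl)
  then have "{x. q \<le> cdf std_normal_distribution x} \<noteq> {}"
    by (auto intro: less_imp_le)
  then show ?thesis
    unfolding quantile_def
  proof (rule cInf_greatest)
    fix x assume "x \<in> {x. q \<le> cdf std_normal_distribution x}"
    then show "0 \<le> x"
      using cdf_std_normal_le_half[of x] assms(1) by fastforce
  qed
qed

text \<open>Supplies nonemptiness of the ambiguity set. The nominal vector is the centre of the box,
  so beyond being a probability vector it needs only nonnegative radii.\<close>

lemma p_hat_in_ambiguity_set:
  fixes xi :: "'j::finite \<Rightarrow> 'x"
  assumes tau0: "\<And>j. 1 < tau0 j" and alpha: "0 < alpha" "alpha < 1"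
  shows "(\<chi> j. p_hat xi tau0 xh N j)
    \<in> ambiguity_set (p_hat xi tau0 xh N) (r_hat alpha xi tau0 xh N)"
proof -
  define t where "t = tau xi tau0 xh N"
  have t: "1 < t j" for j
  proof -
    have "0 \<le> (\<Sum>i=1..N. indicator {xi j} (xh i) :: real)"
      by (intro sum_nonneg) simp
    then show ?thesis
      using tau0[of j] by (simp add: t_def tau_def)
  qed
  \<comment> \<open>Absorbing the cardinality as a sum of ones shows that the denominator of
    \<open>p_hat\<close> is exactly the sum of its numerators.\<close>
  have excess: "tau_excess xi tau0 xh N = (\<Sum>j\<in>UNIV. t j - 1)"
    by (simp add: tau_excess_def t_def sum_subtractf)
  have pos: "0 < (\<Sum>j\<in>UNIV. t j - 1)"
    using t by (intro sum_pos) auto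
  have nonneg: "0 \<le> p_hat xi tau0 xh N j" for j
    using t[of j] pos by (simp add: p_hat_def excess flip: t_def)
  have sum1: "(\<Sum>j\<in>UNIV. p_hat xi tau0 xh N j) = 1"
    using pos by (simp add: p_hat_def excess flip: t_def sum_divide_distrib)
  have le1: "p_hat xi tau0 xh N j \<le> 1" for j
    using member_le_sum[of j UNIV "p_hat xi tau0 xh N"] nonneg sum1 by simp
  have J: "1 \<le> real CARD('j)"
    by (simp add: Suc_le_eq)
  define alpha' where "alpha' = alpha / real CARD('j)"
  have "alpha' \<le> alpha"
    using alpha J by (simp add: alpha'_def divide_le_eq mult_le_cancel_left1)
  moreover have "0 < alpha'"
    using alpha by (simp add: alpha'_def)
  \<comment> \<open>Since \<open>alpha'\<close> lies strictly between 0 and 1, the level lies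
    strictly between 1/2 and 1.\<close>
  ultimately have "0 \<le> quantile std_normal_distribution (1 - alpha' / 2)"
    using alpha by (intro quantile_std_normal_nonneg) auto
  \<comment> \<open>\<open>sqrt\<close> is negative at negative arguments, so the radicand must be
    shown nonnegative; this is where \<open>p_hat\<close> being at most 1 enters.\<close>
  then have "0 \<le> r_hat alpha xi tau0 xh N j" for j
    using nonneg[of j] le1[of j] pos
    by (simp add: r_hat_def excess del: divide_divide_eq_left flip: alpha'_def)
  then show ?thesis
    using nonneg sum1 by (simp add: ambiguity_set_def prob_vectors_def)
qed

section \<open>The robust Bellman operator\<close>

text \<open>Abstract setting in which \<open>P\<close> is any nonempty set of probability vectors
  and the dynamics keep \<open>S\<close> invariant. The theorem instantiates \<open>P\<close> with
  the ambiguity set.\<close>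

locale robust_mdp =
  fixes S :: "'s set" and A :: "'a set" and xi :: "'j::finite \<Rightarrow> 'x"
    and C :: "'s \<Rightarrow> 'a \<Rightarrow> 'x \<Rightarrow> real" and g :: "'s \<Rightarrow> 'a \<Rightarrow> 'x \<Rightarrow> 's"
    and \<gamma> :: real and P :: "(real ^ 'j) set"
  assumes S_nonempty: "S \<noteq> {}" and A_nonempty: "A \<noteq> {}" and P_nonempty: "P \<noteq> {}"
    and P_prob: "P \<subseteq> prob_vectors"
    and step_in_S: "\<And>s a j. s \<in> S \<Longrightarrow> a \<in> A \<Longrightarrow> g s a (xi j) \<in> S"
    and discount: "0 \<le> \<gamma>" "\<gamma> < 1"
    and bdd_cost: "bdd_above ((\<lambda>(s, a, x). \<bar>C s a x\<bar>) ` (S \<times> A \<times> range xi))"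
begin

abbreviation T :: "('s \<Rightarrow> real) \<Rightarrow> 's \<Rightarrow> real" where
  "T \<equiv> bellman A xi C g \<gamma> P"

definition payoff :: "('s \<Rightarrow> real) \<Rightarrow> 's \<Rightarrow> 'a \<Rightarrow> real ^ 'j \<Rightarrow> real" where
  "payoff V s a p = (\<Sum>j\<in>UNIV. p $ j * (C s a (xi j) + \<gamma> * V (g s a (xi j))))"

text \<open>Fixed point of \<open>M\<close> \<mapsto>
  \<open>cost_bound S A xi C + \<gamma> * M\<close>, so the sup-norm ball of this radius is mapped
  into itself by \<open>T\<close>. Its negative is the initial approximation of a run.\<close>

definition value_bound :: real where
  "value_bound = cost_bound S A xi C / (1 - \<gamma>)"

lemma bellman_eq_payoff: "T V s = (INF a\<in>A. SUP p\<in>P. payoff V s a p)"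
  by (simp add: bellman_def payoff_def)

lemma abs_cost_le: "s \<in> S \<Longrightarrow> a \<in> A \<Longrightarrow> \<bar>C s a (xi j)\<bar> \<le> cost_bound S A xi C"
  unfolding cost_bound_def using cSUP_upper[OF _ bdd_cost, of "(s, a, xi j)"] by simp

lemma value_bound_eq: "cost_bound S A xi C + \<gamma> * value_bound = value_bound"
  using discount by (simp add: value_bound_def field_simps)

lemma value_bound_nonneg: "0 \<le> value_bound"
proof -
  obtain s a where "s \<in> S" "a \<in> A"
    using S_nonempty A_nonempty by blast
  then have "0 \<le> cost_bound S A xi C"
    using abs_cost_le[of s a undefined] by simp
  then show ?thesis
    using discount by (simp add: value_bound_def)
qed

text \<open>A constant shift \<open>d\<close> leaves the expectation with factor
  \<open>\<gamma>\<close> because the weights sum to one. The sign of \<open>d\<close> is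
  arbitrary.\<close>

lemma payoff_le_add:
  assumes "\<And>t. t \<in> S \<Longrightarrow> U t \<le> W t + d" "s \<in> S" "a \<in> A" "p \<in> P"
  shows "payoff U s a p \<le> payoff W s a p + \<gamma> * d"
proof -
  have p: "0 \<le> p $ j" "(\<Sum>j\<in>UNIV. p $ j) = 1" for j
    using assms(4) P_prob by (auto simp: prob_vectors_def)
  have "payoff U s a p
      \<le> (\<Sum>j\<in>UNIV. p $ j * (C s a (xi j) + \<gamma> * (W (g s a (xi j)) + d)))"
    unfolding payoff_def
    using assms(1)[OF step_in_S[OF assms(2,3)]] p(1) discount(1)
    by (intro sum_mono mult_left_mono add_left_mono) auto
  also have "\<dots> = payoff W s a p + (\<Sum>j\<in>UNIV. p $ j * (\<gamma> * d))"
    by (simp add: payoff_def algebra_simps sum.distrib)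
  also have "\<dots> = payoff W s a p + \<gamma> * d"
    using p(2) by (simp flip: sum_distrib_right)
  finally show ?thesis .
qed

section \<open>A priori bounds that make the real suprema and infima meaningful\<close>

lemma abs_payoff_le:
  assumes "\<forall>t\<in>S. \<bar>V t\<bar> \<le> M" "s \<in> S" "a \<in> A" "p \<in> P"
  shows "\<bar>payoff V s a p\<bar> \<le> cost_bound S A xi C + \<gamma> * M"
proof -
  have p: "0 \<le> p $ j" "(\<Sum>j\<in>UNIV. p $ j) = 1" for j
    using assms(4) P_prob by (auto simp: prob_vectors_def)
  have term_le: "\<bar>C s a (xi j) + \<gamma> * V (g s a (xi j))\<bar> \<le> cost_bound S A xi C + \<gamma> * M" for j
  proof -
    have "\<bar>\<gamma> * V (g s a (xi j))\<bar> \<le> \<gamma> * M"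
      using assms(1) step_in_S[OF assms(2,3)] discount(1)
      by (simp add: abs_mult mult_left_mono)
    then show ?thesis
      using abs_cost_le[OF assms(2,3), of j] by linarith
  qed
  have "\<bar>payoff V s a p\<bar> \<le> (\<Sum>j\<in>UNIV. \<bar>p $ j * (C s a (xi j) + \<gamma> * V (g s a (xi j)))\<bar>)"
    unfolding payoff_def by (rule sum_abs)
  also have "\<dots> \<le> (\<Sum>j\<in>UNIV. p $ j * (cost_bound S A xi C + \<gamma> * M))"
    using term_le p(1) by (intro sum_mono) (simp add: abs_mult mult_left_mono)
  also have "\<dots> = cost_bound S A xi C + \<gamma> * M"
    using p(2) by (simp flip: sum_distrib_right)
  finally show ?thesis .
qed

lemma bdd_above_payoff:
  assumes "\<forall>t\<in>S. \<bar>V t\<bar> \<le> M" "s \<in> S" "a \<in> A"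
  shows "bdd_above (payoff V s a ` P)"
proof (rule bdd_aboveI2)
  show "payoff V s a p \<le> cost_bound S A xi C + \<gamma> * M" if "p \<in> P" for p
    using abs_payoff_le[OF assms that] by linarith
qed

lemma abs_worst_payoff_le:
  assumes "\<forall>t\<in>S. \<bar>V t\<bar> \<le> M" "s \<in> S" "a \<in> A"
  shows "\<bar>SUP p\<in>P. payoff V s a p\<bar> \<le> cost_bound S A xi C + \<gamma> * M"
  using abs_payoff_le[OF assms] P_nonempty by (intro cSup_abs_le) auto

lemma bdd_below_worst_payoff:
  assumes "\<forall>t\<in>S. \<bar>V t\<bar> \<le> M" "s \<in> S"
  shows "bdd_below ((\<lambda>a. SUP p\<in>P. payoff V s a p) ` A)"
proof (rule bdd_belowI2)
  show "- (cost_bound S A xi C + \<gamma> * M) \<le> (SUP p\<in>P. payoff V s a p)" if "a \<in> A" for a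
    using abs_worst_payoff_le[OF assms that] by linarith
qed

section \<open>Boundedness, monotonicity and contraction of the operator\<close>

lemma abs_bellman_le:
  assumes "\<forall>t\<in>S. \<bar>V t\<bar> \<le> M" "s \<in> S"
  shows "\<bar>T V s\<bar> \<le> cost_bound S A xi C + \<gamma> * M"
  unfolding bellman_eq_payoff
  using abs_worst_payoff_le[OF assms] A_nonempty by (intro cInf_abs_ge) auto

text \<open>Common source of monotonicity (\<open>d = 0\<close>) and of the one-sided contraction
  estimate. Both functions are evaluated at the same action and distribution before the supremum and
  infimum are taken.\<close>

lemma bellman_le_add:
  assumes U: "\<forall>t\<in>S. \<bar>U t\<bar> \<le> M" and W: "\<forall>t\<in>S. \<bar>W t\<bar> \<le> M'"
    and le: "\<And>t. t \<in> S \<Longrightarrow> U t \<le> W t + d" and s: "s \<in> S"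
  shows "T U s \<le> T W s + \<gamma> * d"
proof -
  \<comment> \<open>With the shift on the left, the bound is constant in \<open>a\<close> and passes
    to the infimum defining \<open>T W s\<close>.\<close>
  have "T U s - \<gamma> * d \<le> (SUP p\<in>P. payoff W s a p)" if a: "a \<in> A" for a
  proof -
    have "T U s \<le> (SUP p\<in>P. payoff U s a p)"
      unfolding bellman_eq_payoff by (intro cINF_lower bdd_below_worst_payoff[OF U s] a)
    also have "\<dots> \<le> (SUP p\<in>P. payoff W s a p) + \<gamma> * d"
    proof (rule cSUP_least[OF P_nonempty])
      fix p assume p: "p \<in> P"
      have "payoff U s a p \<le> payoff W s a p + \<gamma> * d"
        using le s a p by (rule payoff_le_add)
      also have "payoff W s a p \<le> (SUP p\<in>P. payoff W s a p)"
        using p bdd_above_payoff[OF W s a] by (rule cSUP_upper)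
      finally show "payoff U s a p \<le> (SUP p\<in>P. payoff W s a p) + \<gamma> * d"
        by simp
    qed
    finally show ?thesis
      by simp
  qed
  then have "T U s - \<gamma> * d \<le> T W s"
    unfolding bellman_eq_payoff[of W] by (rule cINF_greatest[OF A_nonempty])
  then show ?thesis
    by simp
qed

lemma bellman_mono:
  assumes "\<forall>t\<in>S. \<bar>U t\<bar> \<le> M" "\<forall>t\<in>S. \<bar>W t\<bar> \<le> M'"
    and "\<And>t. t \<in> S \<Longrightarrow> U t \<le> W t" "s \<in> S"
  shows "T U s \<le> T W s"
  using bellman_le_add[of U M W M' 0 s] assms by simp

text \<open>The largest excess \<open>d\<close> of \<open>U\<close> over \<open>W\<close> satisfies
  \<open>d \<le> \<gamma> * d\<close>, which forces \<open>d \<le> 0\<close> because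
  \<open>\<gamma> < 1\<close>.\<close>

lemma bellman_comparison:
  assumes U: "\<forall>t\<in>S. \<bar>U t\<bar> \<le> M" and W: "\<forall>t\<in>S. \<bar>W t\<bar> \<le> M'"
    and sub: "\<And>t. t \<in> S \<Longrightarrow> U t \<le> T U t" and super: "\<And>t. t \<in> S \<Longrightarrow> T W t \<le> W t"
    and s: "s \<in> S"
  shows "U s \<le> W s"
proof -
  define d where "d = (SUP t\<in>S. U t - W t)"
  have bdd: "bdd_above ((\<lambda>t. U t - W t) ` S)"
  proof (rule bdd_aboveI2)
    show "U t - W t \<le> M + M'" if "t \<in> S" for t
      using bspec[OF U that] bspec[OF W that] by linarith
  qed
  have upper: "U t - W t \<le> d" if "t \<in> S" for t
    unfolding d_def by (rule cSUP_upper[OF that bdd])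
  have "U t - W t \<le> \<gamma> * d" if t: "t \<in> S" for t
  proof -
    have "U r \<le> W r + d" if "r \<in> S" for r
      using upper[OF that] by simp
    then have "T U t \<le> T W t + \<gamma> * d"
      using t by (intro bellman_le_add[OF U W])
    then show ?thesis
      using sub[OF t] super[OF t] by linarith
  qed
  then have "d \<le> \<gamma> * d"
    unfolding d_def by (rule cSUP_least[OF S_nonempty])
  then have "(1 - \<gamma>) * d \<le> 0"
    by (simp add: algebra_simps)
  then have "d \<le> 0"
    using discount(2) by (simp add: mult_le_0_iff)
  then show ?thesis
    using upper[OF s] by simp
qed

section \<open>Existence of a bounded fixed point\<close>

lemma ex_bellman_fixpoint:
  obtains W where "\<forall>t\<in>S. \<bar>W t\<bar> \<le> value_bound" "\<And>s. s \<in> S \<Longrightarrow> T W s = W s"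
proof -
  \<comment> \<open>Knaster-Tarski: the pointwise supremum of the bounded functions lying below their image.\<close>
  define F where
    "F = {V. (\<forall>t\<in>S. \<bar>V t\<bar> \<le> value_bound) \<and> (\<forall>s\<in>S. V s \<le> T V s)}"
  define W where "W s = (SUP V\<in>F. V s)" for s
  have invariant: "\<bar>T V s\<bar> \<le> value_bound" if "\<forall>t\<in>S. \<bar>V t\<bar> \<le> value_bound" "s \<in> S" for V s
    using abs_bellman_le[OF that] value_bound_eq by simp
  have bound: "\<forall>t\<in>S. \<bar>V t\<bar> \<le> value_bound" if "V \<in> F" for V
    using that by (simp add: F_def)
  \<comment> \<open>The least function of the ball is a subsolution, so the supremum runs over a
    nonempty family.\<close>
  have "- value_bound \<le> T (\<lambda>_. - value_bound) s" if "s \<in> S" for s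
    using invariant[OF _ that, of "\<lambda>_. - value_bound"] value_bound_nonneg by (simp add: abs_le_iff)
  then have "(\<lambda>_. - value_bound) \<in> F"
    using value_bound_nonneg by (simp add: F_def)
  then have F_nonempty: "F \<noteq> {}"
    by blast
  have upper: "V s \<le> W s" if "V \<in> F" "s \<in> S" for V s
    unfolding W_def
  proof (rule cSUP_upper[OF that(1)])
    show "bdd_above ((\<lambda>V. V s) ` F)"
    proof (rule bdd_aboveI2)
      show "V s \<le> value_bound" if "V \<in> F" for V
        using bspec[OF bound[OF that] \<open>s \<in> S\<close>] by linarith
    qed
  qed
  have "\<bar>W t\<bar> \<le> value_bound" if "t \<in> S" for t
    unfolding W_def using bound F_nonempty that by (intro cSup_abs_le) auto
  then have W_bound: "\<forall>t\<in>S. \<bar>W t\<bar> \<le> value_bound"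
    by blast
  \<comment> \<open>Each \<open>V\<close> in \<open>F\<close> satisfies
    \<open>V \<le> T V \<le> T W\<close> on \<open>S\<close>; taking the supremum over
    \<open>V\<close> keeps the bound.\<close>
  have W_le: "W s \<le> T W s" if s: "s \<in> S" for s
    unfolding W_def[of s]
  proof (rule cSUP_least[OF F_nonempty])
    fix V assume V: "V \<in> F"
    then have "V s \<le> T V s"
      using s by (simp add: F_def)
    also have "\<dots> \<le> T W s"
      using bound[OF V] W_bound upper[OF V] s by (rule bellman_mono)
    finally show "V s \<le> T W s" .
  qed
  have TW_bound: "\<forall>t\<in>S. \<bar>T W t\<bar> \<le> value_bound"
    using invariant[OF W_bound] by blast
  \<comment> \<open>Applying \<open>T\<close> to \<open>W_le\<close> puts \<open>T W\<close> itself
    into \<open>F\<close>, so \<open>T W \<le> W\<close> on \<open>S\<close>, the missing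
    inequality.\<close>
  have "T W s \<le> T (T W) s" if "s \<in> S" for s
    using W_bound TW_bound W_le that by (rule bellman_mono)
  then have "T W \<in> F"
    using TW_bound by (simp add: F_def)
  then have "T W s = W s" if "s \<in> S" for s
    using upper[of "T W" s] W_le[of s] that by simp
  then show thesis
    using that[of W] W_bound by blast
qed

text \<open>From states in \<open>S\<close> the dynamics stay in \<open>S\<close>, so values
  elsewhere do not matter; formally, monotonicity is used in both directions.\<close>

lemma bellman_cong:
  assumes U: "\<forall>t\<in>S. \<bar>U t\<bar> \<le> M" and eq: "\<And>t. t \<in> S \<Longrightarrow> U t = W t" and s: "s \<in> S"
  shows "T U s = T W s"
proof (rule antisym)
  have W: "\<forall>t\<in>S. \<bar>W t\<bar> \<le> M"
    using U eq by simp
  show "T U s \<le> T W s"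
    by (rule bellman_mono[OF U W _ s]) (simp add: eq)
  show "T W s \<le> T U s"
    by (rule bellman_mono[OF W U _ s]) (simp add: eq)
qed

section \<open>Uniqueness of the fixed point and comparison with subsolutions\<close>

lemma bounded_on_S_iff: "bounded (V ` S) \<longleftrightarrow> (\<exists>M. \<forall>t\<in>S. \<bar>V t\<bar> \<le> M)"
  for V :: "'s \<Rightarrow> real"
  by (simp add: bounded_iff)

text \<open>Each fixed point is both a subsolution and a supersolution, so comparison applies in
  both directions.\<close>

lemma bellman_fixpoint_unique:
  assumes U: "bounded (U ` S)" "\<forall>t\<in>S. T U t = U t" and W: "bounded (W ` S)" "\<forall>t\<in>S. T W t = W t"
    and s: "s \<in> S"
  shows "U s = W s"
proof -
  obtain M M' where b: "\<forall>t\<in>S. \<bar>U t\<bar> \<le> M" "\<forall>t\<in>S. \<bar>W t\<bar> \<le> M'"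
    using U(1) W(1) by (auto simp: bounded_on_S_iff)
  show ?thesis
    using bellman_comparison[OF b _ _ s] bellman_comparison[OF b(2,1) _ _ s] U(2) W(2)
    by (intro antisym) (simp_all only: order_refl)
qed

text \<open>The description operator is informative only after unique existence is shown. The fixed
  point already constructed is restricted to \<open>S\<close>, and extensionality turns agreement on
  \<open>S\<close> into equality.\<close>

lemma bellman_fixpoint_props:
  defines "W \<equiv> bellman_fixpoint S A xi C g \<gamma> P"
  shows "W \<in> extensional S \<and> bounded (W ` S) \<and> (\<forall>s\<in>S. T W s = W s)"
proof -
  obtain W' where W': "\<forall>t\<in>S. \<bar>W' t\<bar> \<le> value_bound" "\<And>s. s \<in> S \<Longrightarrow> T W' s = W' s"
    using ex_bellman_fixpoint by blast
  have "T W' s = T (restrict W' S) s" if "s \<in> S" for s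
    by (rule bellman_cong[OF W'(1) _ that]) simp
  then have fixpoint: "\<forall>s\<in>S. T (restrict W' S) s = restrict W' S s"
    using W'(2) by simp
  have bounded: "bounded (restrict W' S ` S)"
    using W'(1) by (auto simp: bounded_on_S_iff)
  have "V = restrict W' S"
    if V: "V \<in> extensional S \<and> bounded (V ` S) \<and> (\<forall>s\<in>S. T V s = V s)" for V
  proof (rule extensionalityI)
    show "V s = restrict W' S s" if "s \<in> S" for s
      using V bounded fixpoint that by (intro bellman_fixpoint_unique) blast+
  qed (use V in auto)
  then have "\<exists>!V. V \<in> extensional S \<and> bounded (V ` S) \<and> (\<forall>s\<in>S. T V s = V s)"
    using bounded fixpoint by (intro ex1I[of _ "restrict W' S"]) auto
  then show ?thesis
    unfolding W_def bellman_fixpoint_def by (rule theI')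
qed

lemma subsolution_le_bellman_fixpoint:
  assumes "bounded (U ` S)" "\<And>t. t \<in> S \<Longrightarrow> U t \<le> T U t" "s \<in> S"
  shows "U s \<le> bellman_fixpoint S A xi C g \<gamma> P s"
proof -
  let ?W = "bellman_fixpoint S A xi C g \<gamma> P"
  obtain M M' where b: "\<forall>t\<in>S. \<bar>U t\<bar> \<le> M" "\<forall>t\<in>S. \<bar>?W t\<bar> \<le> M'"
    using assms(1) bellman_fixpoint_props by (metis bounded_on_S_iff)
  have "T ?W t \<le> ?W t" if "t \<in> S" for t
    using bellman_fixpoint_props that by (metis order_refl)
  with b assms(2) show ?thesis
    using assms(3) by (rule bellman_comparison)
qed

text \<open>Induction step for a run, with \<open>l\<close> as the cut. Both \<open>U\<close> and
  \<open>l\<close> lie below \<open>T U\<close>, and \<open>U \<le> W\<close> gives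
  \<open>T U \<le> T W\<close>.\<close>

lemma subsolution_max:
  assumes U: "bounded (U ` S)" "\<And>t. t \<in> S \<Longrightarrow> U t \<le> T U t"
    and l: "bounded (l ` S)" "\<And>t. t \<in> S \<Longrightarrow> l t \<le> T U t"
    and W: "\<And>t. t \<in> S \<Longrightarrow> W t = max (U t) (l t)"
  shows "bounded (W ` S)" "\<And>t. t \<in> S \<Longrightarrow> W t \<le> T W t"
proof -
  obtain M M' where M: "\<forall>t\<in>S. \<bar>U t\<bar> \<le> M" and M': "\<forall>t\<in>S. \<bar>l t\<bar> \<le> M'"
    using U(1) l(1) by (auto simp: bounded_on_S_iff)
  have "\<bar>W t\<bar> \<le> max M M'" if "t \<in> S" for t
    using bspec[OF M that] bspec[OF M' that] W[OF that] by (simp add: max_def)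
  then have W_bound: "\<forall>t\<in>S. \<bar>W t\<bar> \<le> max M M'"
    by blast
  then show "bounded (W ` S)"
    by (auto simp: bounded_on_S_iff)
  show "W t \<le> T W t" if t: "t \<in> S" for t
  proof -
    have "T U t \<le> T W t"
      by (rule bellman_mono[OF M W_bound _ t]) (simp add: W)
    then show ?thesis
      using U(2)[OF t] l(2)[OF t] W[OF t] by simp
  qed
qed

text \<open>Base case for a run: \<open>T U\<close> stays in the ball of radius
  \<open>value_bound\<close>, hence above the constant \<open>U\<close>.\<close>

lemma subsolution_lower_bound:
  assumes "\<And>t. t \<in> S \<Longrightarrow> U t = - value_bound"
  shows "bounded (U ` S)" "\<And>t. t \<in> S \<Longrightarrow> U t \<le> T U t"
proof -
  have U: "\<forall>t\<in>S. \<bar>U t\<bar> \<le> value_bound"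
    using assms value_bound_nonneg by simp
  then show "bounded (U ` S)"
    by (auto simp: bounded_on_S_iff)
  show "U t \<le> T U t" if "t \<in> S" for t
    using abs_bellman_le[OF U that] assms[OF that] value_bound_eq by (simp add: abs_le_iff)
qed

end

section \<open>Monotone convergence of the lower approximations\<close>

theorem lemma10:
  fixes S :: "(real ^ 'm) set" and A :: "(real ^ 'n) set"
    and xi :: "'j::finite \<Rightarrow> real ^ 'k"
    and C :: "real ^ 'm \<Rightarrow> real ^ 'n \<Rightarrow> real ^ 'k \<Rightarrow> real"
    and g :: "real ^ 'm \<Rightarrow> real ^ 'n \<Rightarrow> real ^ 'k \<Rightarrow> real ^ 'm"
    and Am :: "real ^ 'k \<Rightarrow> real ^ 'm ^ 'm"
    and Bm :: "real ^ 'k \<Rightarrow> real ^ 'n ^ 'm"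
    and bm :: "real ^ 'k \<Rightarrow> real ^ 'm"
    and \<gamma> alpha :: real
    and tau0 :: "'j \<Rightarrow> real" and xh :: "nat \<Rightarrow> real ^ 'k" and N :: nat
    and ph rh :: "'j \<Rightarrow> real"
    and sb :: "nat \<Rightarrow> real ^ 'm" and V :: "nat \<Rightarrow> real ^ 'm \<Rightarrow> real"
  assumes "S \<noteq> {}" and "A \<noteq> {}" and "inj xi"
    and "\<And>s a x. s \<in> S \<Longrightarrow> a \<in> A \<Longrightarrow> x \<in> range xi \<Longrightarrow> g s a x \<in> S"
    and "0 \<le> \<gamma>" and "\<gamma> < 1"
    and "bdd_above ((\<lambda>(s, a, x). \<bar>C s a x\<bar>) ` (S \<times> A \<times> range xi))"
    and "\<And>j. 1 < tau0 j"
    and "\<And>i. 1 \<le> i \<Longrightarrow> i \<le> N \<Longrightarrow> xh i \<in> range xi"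
    and "0 < alpha" and "alpha < 1"
    and "ph = p_hat xi tau0 xh N" and "rh = r_hat alpha xi tau0 xh N"
    and "0 < L_sum ph rh" and "L_sum ph rh < 1" and "1 < U_sum ph rh"
    and "convex S" and "compact S" and "convex A" and "compact A"
    and "\<And>x. x \<in> range xi \<Longrightarrow> convex_on (S \<times> A) (\<lambda>(s, a). C s a x)"
    and "\<And>x. x \<in> range xi \<Longrightarrow> continuous_on (S \<times> A) (\<lambda>(s, a). C s a x)"
    and "\<And>s a x. s \<in> S \<Longrightarrow> a \<in> A \<Longrightarrow> x \<in> range xi \<Longrightarrow> g s a x = Am x *v s + Bm x *v a + bm x"
    and "Am \<in> borel_measurable (restrict_space borel (range xi))"
    and "Bm \<in> borel_measurable (restrict_space borel (range xi))"
    and "bm \<in> borel_measurable (restrict_space borel (range xi))"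
    and "bocp_run S A xi C g Am Bm bm \<gamma> ph rh sb V"
  shows "(\<forall>k. \<forall>s\<in>S. V k s \<le> V (Suc k) s \<and>
              V (Suc k) s \<le> bellman_fixpoint S A xi C g \<gamma> (ambiguity_set ph rh) s) \<and>
         (\<forall>s\<in>S. convergent (\<lambda>k. V k s) \<and>
              lim (\<lambda>k. V k s) \<le> bellman_fixpoint S A xi C g \<gamma> (ambiguity_set ph rh) s)"
proof -
  let ?P = "ambiguity_set ph rh"
  let ?W = "bellman_fixpoint S A xi C g \<gamma> ?P"
  have "(\<chi> j. ph j) \<in> ?P"
    unfolding \<open>ph = p_hat xi tau0 xh N\<close> \<open>rh = r_hat alpha xi tau0 xh N\<close>
    using assms(8) \<open>0 < alpha\<close> \<open>alpha < 1\<close> by (rule p_hat_in_ambiguity_set)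
  then have "?P \<noteq> {}"
    by blast
  moreover have "?P \<subseteq> prob_vectors"
    by (auto simp: ambiguity_set_def)
  ultimately interpret robust_mdp S A xi C g \<gamma> ?P
    using assms(1-7) by unfold_locales auto
  have V0: "V 0 s = - value_bound" if "s \<in> S" for s
    using \<open>bocp_run S A xi C g Am Bm bm \<gamma> ph rh sb V\<close> that
    by (simp add: bocp_run_def value_bound_def)
  \<comment> \<open>Reads off from a step the affine minorant of \<open>T (V k)\<close> based at
    \<open>sb k\<close> and the update by maximum.\<close>
  have cut: "\<exists>v q. (\<forall>t\<in>S. v + q \<bullet> (t - sb k) \<le> T (V k) t) \<and>
      (\<forall>t\<in>S. V (Suc k) t = max (V k t) (v + q \<bullet> (t - sb k)))" for k
    using \<open>bocp_run S A xi C g Am Bm bm \<gamma> ph rh sb V\<close>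
    unfolding bocp_run_def bocp_step_def Let_def by blast
  \<comment> \<open>A cut is continuous, hence bounded on the compact \<open>S\<close>, as
    \<open>subsolution_max\<close> requires.\<close>
  have bounded_cut: "bounded ((\<lambda>t. v + q \<bullet> (t - c)) ` S)" for v :: real and q c :: "real ^ 'm"
    by (intro compact_imp_bounded compact_continuous_image continuous_intros \<open>compact S\<close>)
  \<comment> \<open>Boundedness is part of the invariant because monotonicity and comparison are
    available for bounded functions.\<close>
  have sub: "bounded (V k ` S) \<and> (\<forall>t\<in>S. V k t \<le> T (V k) t)" for k
  proof (induction k)
    case 0
    show ?case
      using subsolution_lower_bound[of "V 0"] V0 by blast
  next
    case (Suc k)
    obtain v q where vq: "\<forall>t\<in>S. v + q \<bullet> (t - sb k) \<le> T (V k) t"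
      "\<forall>t\<in>S. V (Suc k) t = max (V k t) (v + q \<bullet> (t - sb k))"
      using cut by blast
    show ?case
      using subsolution_max[of "V k" "\<lambda>t. v + q \<bullet> (t - sb k)" "V (Suc k)"] Suc vq bounded_cut
      by blast
  qed
  have le: "V k s \<le> ?W s" if "s \<in> S" for k s
    using sub[of k] that by (intro subsolution_le_bellman_fixpoint) auto
  have mono: "V k s \<le> V (Suc k) s" if "s \<in> S" for k s
    using cut[of k] that by force
  have "convergent (\<lambda>k. V k s) \<and> lim (\<lambda>k. V k s) \<le> ?W s" if s: "s \<in> S" for s
  proof -
    \<comment> \<open>At a fixed state the values increase and are bounded by \<open>?W s\<close>,
      so they converge and the limit inherits the bound.\<close>
    have "incseq (\<lambda>k. V k s)"
      using mono s by (intro incseq_SucI) auto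
    then obtain L where "(\<lambda>k. V k s) \<longlonglongrightarrow> L"
      using incseq_convergent[of "\<lambda>k. V k s"] le[OF s] by blast
    then show ?thesis
      using le[OF s] by (auto simp: convergent_def limI intro: LIMSEQ_le_const2)
  qed
  with mono le show ?thesis
    by blast
qed

end
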